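(* Let $K$ be an axis-parallel rectangular element with tensor-product Gauss--Legendre--Lobatto (GLL) nodes, $\Delta t>0$, and let the forward-Euler update of the cell average be $$\overline{\mathbb W}_K^{\,n+1}=\frac14\sum_{\boldsymbol\ell}\omega_{\ell_1}\omega_{\ell_2}\bigl(\mathbb W_{\boldsymbol\ell}+\Delta t\,\mathbb S^h_{\boldsymbol\ell}\bigr)-\frac{\Delta t}{|K|}\sum_{f\subset\partial K}\sum_{q=0}^NJ_f\omega_q\widehat{\mathbb H}^{\mathrm{LLF}}_{n,f,q}.$$ Assume $w>0$ at every volume GLL node of $K$ and at every face node at which a local Lax--Friedrichs (LLF) flux is evaluated. Assume that all volume states and both states at every such face node belong to $\mathcal G$, that the prescribed face geometry is single-valued, and that the LLF dissipation speeds satisfy $$a_{f,q}\ge a^{\mathrm{PCP}}_{I(f)}.$$ Let $\boldsymbol\ell(f,q)$ denote the volume GLL node of $K$ coinciding with the face node $(f,q)$. If, for every volume node $\boldsymbol\ell$, $$\Delta t\left[\lambda_{S,\boldsymbol\ell}+\frac{4}{\omega_{\ell_1}\omega_{\ell_2}|K|}\sum_{\substack{(f,q):\\ \boldsymbol\ell(f,q)=\boldsymbol\ell}}\omega_qJ_fa_{f,q}\right]<1,$$ then $\overline{\mathbb W}_K^{\,n+1}\in\mathcal G$.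
   Context: Indices $I,J,a\in\{1,2\}$; repeated indices are summed unless stated otherwise. Fix $1<\Gamma\le2$. Admissible cone. For $Z=(D,m,E)^T$ with $D,E\in\mathbb R$, $m\in\mathbb R^2$, $R(Z)=\sqrt{D^2+|m|^2}$, $q(Z)=E-R(Z)$, $\mathcal G=\{Z: D>0,\ q(Z)>0\}$; $\overline{\mathcal G}$ is its closure. Fluid state. For $\rho>0$, $p>0$, $\widehat v\in\mathbb R^2$ with $|\widehat v|<1$ put $L=(1-|\widehat v|^2)^{-1/2}$, $h=1+\frac{\Gamma p}{(\Gamma-1)\rho}$, $D=\rho L$, $\widehat m=\rho hL^2\widehat v$, $E=\rho hL^2-p$, $\widehat U=(D,\widehat m_1,\widehat m_2,E)^T$, $\widehat F^a=(D\widehat v_a,\ \widehat m_1\widehat v_a+p\delta_{1a},\ \widehat m_2\widehat v_a+p\delta_{2a},\ \widehat m_a)^T$. The map $(\rho,\widehat v,p)\mapsto\widehat U$ is a bijection onto $\mathcal G$, so $\widehat F^a$ is a function of $\widehat U\in\mathcal G$. Geometry. Prescribed smooth time-independent functions of the active coordinates: $\alpha>0$, $\beta^I$, symmetric positive definite $\gamma_{IJ}$ (inverse $\gamma^{IJ}$), weight $w$. $j_2=\sqrt{\det(\gamma_{IJ})}$; $\Theta$ is upper triangular with positive diagonal and $\Theta^T\Theta=(\gamma_{IJ})^{-1}$; $A_{aI}=\alpha j_2\Theta_{aI}$ (so $A_{21}=0$), $C^I=j_2\beta^I$, $\mathcal A_{aI}=wA_{aI}$, $\mathcal C^I=wC^I$.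 The evolved state is $\mathbb W=wj_2\widehat U$, so $\widehat U=\mathbb W/(wj_2)$; the flux is $\mathbb H^I=\mathcal A_{aI}\widehat F^a-\mathcal C^I\widehat U$. The causal speed (no sum over $I$) is $a_I^{\mathrm{PCP}}=|\beta^I|+\alpha\sqrt{\gamma^{II}}$. Element. $K=[x^1_L,x^1_R]\times[x^2_L,x^2_R]$, $\Delta x_I=x^I_R-x^I_L$, $J_K=\Delta x_1\Delta x_2/4$, $|K|=4J_K$, $\kappa_I=2/\Delta x_I$. $\xi_0,\dots,\xi_N$ are the GLL nodes on $[-1,1]$ with positive weights $\omega_i$ and Lagrange basis $\ell_i$; volume nodes are indexed by $\boldsymbol\ell=(\ell_1,\ell_2)$. $\mathsf D_{ij}=\ell_j'(\xi_i)$ and $\mathsf D_I$ applies $\mathsf D$ to nodal fields in the $I$-th index. The cell average is $\overline{\mathbb W}_K=\frac14\sum_{\boldsymbol\ell}\omega_{\ell_1}\omega_{\ell_2}\mathbb W_{\boldsymbol\ell}$. Faces. A face $f\subset\partial K$ is normal to direction $I(f)$, has outward normal $n=\varepsilon_{K,f}e_{I(f)}$, $\varepsilon_{K,f}=\pm1$, and $J_f=J_K\kappa_{I(f)}$; its GLL nodes are $(f,q)$, $0\le q\le N$. At $(f,q)$ the interior state $\mathbb W^-$ is the value of $\mathbb W$ at the coinciding volume node of $K$ and $\mathbb W^+$ is the exterior state; with $\mathbb H_n^\pm=n_I\mathbb H^{I}(\mathbb W^\pm)$, $\widehat{\mathbb H}^{\mathrm{LLF}}_{n,f,q}=\frac12(\mathbb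 H_n^-+\mathbb H_n^+)-\frac{a_{f,q}}2(\mathbb W^+-\mathbb W^-)$. Discrete source. Let $\mu,\nu\in\{0,1,2\}$ with $x^0=t$, $g_{00}=-\alpha^2+\gamma_{IJ}\beta^I\beta^J$, $g_{0I}=\gamma_{IJ}\beta^J$, $g_{IJ}=\gamma_{IJ}$, inverse $g^{\mu\nu}$ (so $g^{0I}=\beta^I/\alpha^2$), Christoffel symbols $\Gamma^\sigma_{\mu\nu}$; $v^I=\Theta_{aI}\widehat v_a$, $\widetilde v^I=v^I-\beta^I/\alpha$, $u^0=L/\alpha$, $u^I=L\widetilde v^I$, $T^{\mu\nu}=\rho hu^\mu u^\nu+pg^{\mu\nu}$, $S_I=\rho hL^2\gamma_{IJ}v^J$, $F_{\rm V}^I=(D\widetilde v^I,\ S_1\widetilde v^I+p\delta^I_1,\ S_2\widetilde v^I+p\delta^I_2,\ E\widetilde v^I+pv^I)^T$, $\mathcal S_{\rm V}^{\rm act}=(0,\ \frac12T^{\mu\nu}\partial_1g_{\mu\nu},\ \frac12T^{\mu\nu}\partial_2g_{\mu\nu},\ T^{I0}\partial_I\alpha-\alpha T^{\mu\nu}\Gamma^0_{\mu\nu})^T$, $\mathcal L=\operatorname{diag}(1,\Theta,1)$, $\mathcal S_W=\alpha j_2[\mathcal L\mathcal S_{\rm V}^{\rm act}+(\partial_I\mathcal L)F_{\rm V}^I]$. The map from $(\alpha,\beta^I,\gamma_{IJ})$ to $(j_2,A_{11},A_{12},A_{22},C^1,C^2)$ is a smooth local change of variables, so, for fixed state and geometry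 values, $\mathcal S_W$ is linear in the first derivatives of these variables; $B$ are the coefficient vectors in $\mathcal S_W=B_{j_2}^I\partial_Ij_2+B_{A_{aJ}}^I\partial_IA_{aJ}+B_{C^J}^I\partial_IC^J$ (entries $a\le J$ for $A$). Put $P_\perp^I=(0,\alpha j_2\Theta_{1I}p,\alpha j_2\Theta_{2I}p,\alpha^2j_2g^{0I}p)^T$, $R_w^I=P_\perp^I-B_{A_{aJ}}^IA_{aJ}-B_{C^J}^IC^J$, and $\mathbb S^h_{\boldsymbol\ell}=\sum_I\kappa_I[wB_{j_2}^I\mathsf D_Ij_2+B_{A_{aJ}}^I\mathsf D_I(wA_{aJ})+B_{C^J}^I\mathsf D_I(wC^J)+R_w^I\mathsf D_Iw]_{\boldsymbol\ell}$. Source escape rate. At a volume node with state $\mathbb W\in\mathcal G$ and source $\mathbb S^h$, $\lambda_S=0$ if $\mathbb S^h\in\overline{\mathcal G}$; otherwise $\lambda_S>0$ is determined by $\mathbb W+t\mathbb S^h\in\mathcal G$ for $0\le t<\lambda_S^{-1}$ and $\mathbb W+\mathbb S^h/\lambda_S\in\partial\mathcal G$. *)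

theory Defs
  imports "HOL-Analysis.Analysis" "HOL-Computational_Algebra.Polynomial"
begin

section \<open>States and the admissible cone\<close>

text \<open>A conserved vector \<open>(D, m, E)\<^sup>T\<close> is kept in block form. The product norm topology is the
  Euclidean topology of four-dimensional space.\<close>

type_synonym state = "real \<times> (real^2) \<times> real"

definition R_fun :: "state \<Rightarrow> real" where
  "R_fun Z = (case Z of (D, m, E) \<Rightarrow> sqrt (D\<^sup>2 + (norm m)\<^sup>2))"

definition q_fun :: "state \<Rightarrow> real" where
  "q_fun Z = (case Z of (D, m, E) \<Rightarrow> E - R_fun Z)"

definition adm_cone :: "state set" where
  "adm_cone = {Z. fst Z > 0 \<and> q_fun Z > 0}"

text \<open>Primitive variables are triples \<open>(\<rho>, v, p)\<close>; \<open>v\<close> is the velocity in the orthonormal frame.\<close>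

type_synonym prim = "real \<times> (real^2) \<times> real"

definition prim_set :: "prim set" where
  "prim_set = {(\<rho>, v, p). \<rho> > 0 \<and> norm v < 1 \<and> p > 0}"

definition lorentz :: "real^2 \<Rightarrow> real" where
  "lorentz v = 1 / sqrt (1 - (norm v)\<^sup>2)"

definition enthalpy :: "real \<Rightarrow> real \<Rightarrow> real \<Rightarrow> real" where
  "enthalpy \<Gamma> \<rho> p = 1 + \<Gamma> * p / ((\<Gamma> - 1) * \<rho>)"

definition cons_of_prim :: "real \<Rightarrow> prim \<Rightarrow> state" where
  "cons_of_prim \<Gamma> P = (case P of (\<rho>, v, p) \<Rightarrow>
     (\<rho> * lorentz v,
      (\<rho> * enthalpy \<Gamma> \<rho> p * (lorentz v)\<^sup>2) *\<^sub>R v,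
      \<rho> * enthalpy \<Gamma> \<rho> p * (lorentz v)\<^sup>2 - p))"

text \<open>For \<open>1 < \<Gamma> \<le> 2\<close> the map \<^term>\<open>cons_of_prim \<Gamma>\<close> is a bijection from \<^const>\<open>prim_set\<close> onto
  \<^const>\<open>adm_cone\<close>; the following is its inverse, meaningful on \<^const>\<open>adm_cone\<close> only.\<close>

definition prim_of_cons :: "real \<Rightarrow> state \<Rightarrow> prim" where
  "prim_of_cons \<Gamma> = inv_into prim_set (cons_of_prim \<Gamma>)"

definition fluid_flux :: "real \<Rightarrow> 2 \<Rightarrow> state \<Rightarrow> state" where
  "fluid_flux \<Gamma> a U = (case U of (D, m, E) \<Rightarrow> case prim_of_cons \<Gamma> U of (\<rho>, v, p) \<Rightarrow>
     (D * v $ a, (v $ a) *\<^sub>R m + p *\<^sub>R axis a 1, m $ a))"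

section \<open>Geometry\<close>

record geometry =
  lapse :: real
  shiftv :: "real^2"
  gam :: "real^2^2"

definition theta :: "geometry \<Rightarrow> real^2^2" where
  "theta g = (THE T. T $ 2 $ 1 = 0 \<and> T $ 1 $ 1 > 0 \<and> T $ 2 $ 2 > 0 \<and>
                     transpose T ** T = matrix_inv (gam g))"

definition j2 :: "geometry \<Rightarrow> real" where
  "j2 g = sqrt (det (gam g))"

definition A_geo :: "geometry \<Rightarrow> 2 \<Rightarrow> 2 \<Rightarrow> real" where
  "A_geo g a I = lapse g * j2 g * theta g $ a $ I"

definition C_geo :: "geometry \<Rightarrow> 2 \<Rightarrow> real" where
  "C_geo g I = j2 g * shiftv g $ I"

definition causal_speed :: "geometry \<Rightarrow> 2 \<Rightarrow> real" where
  "causal_speed g I = \<bar>shiftv g $ I\<bar> + lapse g * sqrt (matrix_inv (gam g) $ I $ I)"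

text \<open>\<open>fluid_state g c W\<close> recovers the undensitized state from the evolved state, and
  \<open>flux \<Gamma> g c I W\<close> is the weighted flux; \<open>c\<close> is the value of the weight.\<close>

definition fluid_state :: "geometry \<Rightarrow> real \<Rightarrow> state \<Rightarrow> state" where
  "fluid_state g c W = (1 / (c * j2 g)) *\<^sub>R W"

definition flux :: "real \<Rightarrow> geometry \<Rightarrow> real \<Rightarrow> 2 \<Rightarrow> state \<Rightarrow> state" where
  "flux \<Gamma> g c I W =
     (\<Sum>a\<in>UNIV. (c * A_geo g a I) *\<^sub>R fluid_flux \<Gamma> a (fluid_state g c W))
       - (c * C_geo g I) *\<^sub>R fluid_state g c W"

definition pd :: "2 \<Rightarrow> (real^2 \<Rightarrow> real) \<Rightarrow> real^2 \<Rightarrow> real" where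
  "pd I f x = frechet_derivative f (at x) (axis I 1)"

text \<open>\<open>Ck k S f\<close>: on the open set \<open>S\<close>, \<open>f\<close> is \<open>k\<close> times continuously differentiable.\<close>

primrec Ck :: "nat \<Rightarrow> (real^2) set \<Rightarrow> (real^2 \<Rightarrow> real) \<Rightarrow> bool" where
  "Ck 0 S f \<longleftrightarrow> continuous_on S f"
| "Ck (Suc k) S f \<longleftrightarrow> (\<forall>x\<in>S. f differentiable (at x)) \<and> (\<forall>I. Ck k S (pd I f))"

definition smooth_fun :: "(real^2) set \<Rightarrow> (real^2 \<Rightarrow> real) \<Rightarrow> bool" where
  "smooth_fun S f \<longleftrightarrow> (\<forall>k. Ck k S f)"

definition smooth_geometry :: "(real^2) set \<Rightarrow> (real^2 \<Rightarrow> geometry) \<Rightarrow> bool" where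
  "smooth_geometry S geo \<longleftrightarrow>
     smooth_fun S (\<lambda>x. lapse (geo x)) \<and>
     (\<forall>I. smooth_fun S (\<lambda>x. shiftv (geo x) $ I)) \<and>
     (\<forall>I J. smooth_fun S (\<lambda>x. gam (geo x) $ I $ J)) \<and>
     (\<forall>x\<in>S. lapse (geo x) > 0 \<and> transpose (gam (geo x)) = gam (geo x) \<and>
            (\<forall>u. u \<noteq> 0 \<longrightarrow> u \<bullet> (gam (geo x) *v u) > 0))"

section \<open>Pointwise geometric source\<close>

text \<open>Spacetime indices are the elements \<open>0, 1, 2\<close> of the three-element type, with \<open>0\<close> the time
  index. (In the two-element type the numeral \<open>2\<close> equals \<open>0\<close>, so the embedding is explicit.)\<close>

definition sp :: "2 \<Rightarrow> 3" where
  "sp I = (if I = 1 then 1 else 2)"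

definition unsp :: "3 \<Rightarrow> 2" where
  "unsp \<mu> = (if \<mu> = 1 then 1 else 2)"

definition metric :: "geometry \<Rightarrow> real^3^3" where
  "metric g = (\<chi> \<mu> \<nu>.
     if \<mu> = 0 \<and> \<nu> = 0 then - (lapse g)\<^sup>2 + shiftv g \<bullet> (gam g *v shiftv g)
     else if \<mu> = 0 then (gam g *v shiftv g) $ unsp \<nu>
     else if \<nu> = 0 then (gam g *v shiftv g) $ unsp \<mu>
     else gam g $ unsp \<mu> $ unsp \<nu>)"

definition inv_metric :: "geometry \<Rightarrow> real^3^3" where
  "inv_metric g = matrix_inv (metric g)"

text \<open>Spacetime partial derivative of a time-independent function.\<close>

definition pd4 :: "3 \<Rightarrow> (real^2 \<Rightarrow> real) \<Rightarrow> real^2 \<Rightarrow> real" where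
  "pd4 \<mu> f x = (if \<mu> = 0 then 0 else pd (unsp \<mu>) f x)"

definition christoffel :: "(real^2 \<Rightarrow> geometry) \<Rightarrow> real^2 \<Rightarrow> 3 \<Rightarrow> 3 \<Rightarrow> 3 \<Rightarrow> real" where
  "christoffel geo x \<sigma> \<mu> \<nu> = (\<Sum>\<tau>\<in>UNIV. inv_metric (geo x) $ \<sigma> $ \<tau> / 2 *
     (pd4 \<mu> (\<lambda>y. metric (geo y) $ \<tau> $ \<nu>) x + pd4 \<nu> (\<lambda>y. metric (geo y) $ \<tau> $ \<mu>) x
       - pd4 \<tau> (\<lambda>y. metric (geo y) $ \<mu> $ \<nu>) x))"

text \<open>Fluid quantities at a point with geometry values \<open>g\<close>, as functions of the primitive
  variables. \<open>coord_vel\<close> is \<open>v\<^sup>I\<close> and \<open>transport_vel\<close> is \<open>v\<^sup>I - \<beta>\<^sup>I / \<alpha>\<close>.\<close>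

definition coord_vel :: "geometry \<Rightarrow> real^2 \<Rightarrow> real^2" where
  "coord_vel g v = transpose (theta g) *v v"

definition transport_vel :: "geometry \<Rightarrow> real^2 \<Rightarrow> real^2" where
  "transport_vel g v = coord_vel g v - (1 / lapse g) *\<^sub>R shiftv g"

definition four_vel :: "geometry \<Rightarrow> real^2 \<Rightarrow> 3 \<Rightarrow> real" where
  "four_vel g v \<mu> = (if \<mu> = 0 then lorentz v / lapse g
                     else lorentz v * transport_vel g v $ unsp \<mu>)"

definition stress :: "real \<Rightarrow> geometry \<Rightarrow> prim \<Rightarrow> 3 \<Rightarrow> 3 \<Rightarrow> real" where
  "stress \<Gamma> g P \<mu> \<nu> = (case P of (\<rho>, v, p) \<Rightarrow>
     \<rho> * enthalpy \<Gamma> \<rho> p * four_vel g v \<mu> * four_vel g v \<nu> + p * inv_metric g $ \<mu> $ \<nu>)"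

definition momentum :: "real \<Rightarrow> geometry \<Rightarrow> prim \<Rightarrow> real^2" where
  "momentum \<Gamma> g P = (case P of (\<rho>, v, p) \<Rightarrow>
     (\<rho> * enthalpy \<Gamma> \<rho> p * (lorentz v)\<^sup>2) *\<^sub>R (gam g *v coord_vel g v))"

definition valencia_flux :: "real \<Rightarrow> geometry \<Rightarrow> state \<Rightarrow> 2 \<Rightarrow> state" where
  "valencia_flux \<Gamma> g U I = (case U of (D, m, E) \<Rightarrow> case prim_of_cons \<Gamma> U of (\<rho>, v, p) \<Rightarrow>
     (D * transport_vel g v $ I,
      (transport_vel g v $ I) *\<^sub>R momentum \<Gamma> g (\<rho>, v, p) + p *\<^sub>R axis I 1,
      E * transport_vel g v $ I + p * coord_vel g v $ I))"

definition valencia_source :: "real \<Rightarrow> (real^2 \<Rightarrow> geometry) \<Rightarrow> real^2 \<Rightarrow> state \<Rightarrow> state" where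
  "valencia_source \<Gamma> geo x U = (let T = stress \<Gamma> (geo x) (prim_of_cons \<Gamma> U) in
     (0,
      \<chi> J. (\<Sum>\<mu>\<in>UNIV. \<Sum>\<nu>\<in>UNIV. T \<mu> \<nu> * pd J (\<lambda>y. metric (geo y) $ \<mu> $ \<nu>) x) / 2,
      (\<Sum>I\<in>UNIV. T (sp I) 0 * pd I (\<lambda>y. lapse (geo y)) x)
        - lapse (geo x) * (\<Sum>\<mu>\<in>UNIV. \<Sum>\<nu>\<in>UNIV. T \<mu> \<nu> * christoffel geo x 0 \<mu> \<nu>)))"

text \<open>\<open>bdiag c M d\<close> is multiplication by the block matrix \<open>diag(c, M, d)\<close>.\<close>

definition bdiag :: "real \<Rightarrow> real^2^2 \<Rightarrow> real \<Rightarrow> state \<Rightarrow> state" where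
  "bdiag c M d Z = (case Z of (D, m, E) \<Rightarrow> (c * D, M *v m, d * E))"

definition pd_theta :: "2 \<Rightarrow> (real^2 \<Rightarrow> geometry) \<Rightarrow> real^2 \<Rightarrow> real^2^2" where
  "pd_theta I geo x = (\<chi> a J. pd I (\<lambda>y. theta (geo y) $ a $ J) x)"

definition source_W :: "real \<Rightarrow> (real^2 \<Rightarrow> geometry) \<Rightarrow> real^2 \<Rightarrow> state \<Rightarrow> state" where
  "source_W \<Gamma> geo x U = (lapse (geo x) * j2 (geo x)) *\<^sub>R
     (bdiag 1 (theta (geo x)) 1 (valencia_source \<Gamma> geo x U)
       + (\<Sum>I\<in>UNIV. bdiag 0 (pd_theta I geo x) 0 (valencia_flux \<Gamma> (geo x) U I)))"

text \<open>The variables \<open>(j\<^sub>2, A\<^sub>1\<^sub>1, A\<^sub>1\<^sub>2, A\<^sub>2\<^sub>2, C\<^sup>1, C\<^sup>2)\<close> replacing \<open>(\<alpha>, \<beta>\<^sup>I, \<gamma>\<^sub>I\<^sub>J)\<close>; the entry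
  \<open>A\<^sub>2\<^sub>1 = 0\<close> is not a variable.\<close>

datatype gvar = Vj2 | VA11 | VA12 | VA22 | VC1 | VC2

primrec gval :: "geometry \<Rightarrow> gvar \<Rightarrow> real" where
  "gval g Vj2 = j2 g"
| "gval g VA11 = A_geo g 1 1"
| "gval g VA12 = A_geo g 1 2"
| "gval g VA22 = A_geo g 2 2"
| "gval g VC1 = C_geo g 1"
| "gval g VC2 = C_geo g 2"

definition AC_vars :: "gvar set" where
  "AC_vars = {VA11, VA12, VA22, VC1, VC2}"

text \<open>\<open>source_coeffs \<Gamma> U g k I\<close> is the coefficient vector of the derivative \<open>\<partial>\<^sub>I\<close> of the variable
  \<open>k\<close> in \<^const>\<open>source_W\<close>, for fixed fluid state \<open>U\<close> and geometry values \<open>g\<close>. Only the first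
  derivatives of the geometry are left free, which is expressed by letting the geometry range over
  all smooth fields, near any point, that take the value \<open>g\<close> there. The coefficients are unique
  because the passage to the variables \<open>k\<close> is a local diffeomorphism.\<close>

definition is_source_coeffs ::
    "real \<Rightarrow> state \<Rightarrow> geometry \<Rightarrow> (gvar \<Rightarrow> 2 \<Rightarrow> state) \<Rightarrow> bool" where
  "is_source_coeffs \<Gamma> U g B \<longleftrightarrow>
     (\<forall>S geo x. open S \<and> smooth_geometry S geo \<and> x \<in> S \<and> geo x = g \<longrightarrow>
        source_W \<Gamma> geo x U =
          (\<Sum>k\<in>insert Vj2 AC_vars. \<Sum>I\<in>UNIV. pd I (\<lambda>y. gval (geo y) k) x *\<^sub>R B k I))"

definition source_coeffs :: "real \<Rightarrow> state \<Rightarrow> geometry \<Rightarrow> gvar \<Rightarrow> 2 \<Rightarrow> state" where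
  "source_coeffs \<Gamma> U g = (THE B. is_source_coeffs \<Gamma> U g B)"

definition P_perp :: "real \<Rightarrow> state \<Rightarrow> geometry \<Rightarrow> 2 \<Rightarrow> state" where
  "P_perp \<Gamma> U g I = (case prim_of_cons \<Gamma> U of (\<rho>, v, p) \<Rightarrow>
     (0,
      \<chi> a. lapse g * j2 g * theta g $ a $ I * p,
      (lapse g)\<^sup>2 * j2 g * inv_metric g $ 0 $ sp I * p))"

definition R_weight :: "real \<Rightarrow> state \<Rightarrow> geometry \<Rightarrow> 2 \<Rightarrow> state" where
  "R_weight \<Gamma> U g I = P_perp \<Gamma> U g I - (\<Sum>k\<in>AC_vars. gval g k *\<^sub>R source_coeffs \<Gamma> U g k I)"

section \<open>Gauss-Legendre-Lobatto rule and the element\<close>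

definition legendre_poly :: "nat \<Rightarrow> real poly" where
  "legendre_poly n = smult (1 / (2 ^ n * fact n)) ((pderiv ^^ n) ([:-1, 0, 1:] ^ n))"

definition lagrange_poly :: "nat \<Rightarrow> (nat \<Rightarrow> real) \<Rightarrow> nat \<Rightarrow> real poly" where
  "lagrange_poly N \<xi> i = (\<Prod>k\<in>{0..N} - {i}. smult (1 / (\<xi> i - \<xi> k)) [:- \<xi> k, 1:])"

definition GLL :: "nat \<Rightarrow> (nat \<Rightarrow> real) \<Rightarrow> (nat \<Rightarrow> real) \<Rightarrow> bool" where
  "GLL N \<xi> \<omega> \<longleftrightarrow>
     1 \<le> N \<and> strict_mono_on {0..N} \<xi> \<and> \<xi> 0 = -1 \<and> \<xi> N = 1 \<and>
     (\<forall>i. 0 < i \<and> i < N \<longrightarrow> poly (pderiv (legendre_poly N)) (\<xi> i) = 0) \<and>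
     (\<forall>i\<le>N. \<omega> i = integral {-1..1} (poly (lagrange_poly N \<xi> i)) \<and> \<omega> i > 0)"

definition D_mat :: "nat \<Rightarrow> (nat \<Rightarrow> real) \<Rightarrow> nat \<Rightarrow> nat \<Rightarrow> real" where
  "D_mat N \<xi> i j = poly (pderiv (lagrange_poly N \<xi> j)) (\<xi> i)"

type_synonym node = "nat \<times> nat"

definition vol_nodes :: "nat \<Rightarrow> node set" where
  "vol_nodes N = {0..N} \<times> {0..N}"

definition idx :: "node \<Rightarrow> 2 \<Rightarrow> nat" where
  "idx l I = (if I = 1 then fst l else snd l)"

definition set_idx :: "node \<Rightarrow> 2 \<Rightarrow> nat \<Rightarrow> node" where
  "set_idx l I k = (if I = 1 then (k, snd l) else (fst l, k))"

definition D_dir :: "nat \<Rightarrow> (nat \<Rightarrow> real) \<Rightarrow> 2 \<Rightarrow> (node \<Rightarrow> real) \<Rightarrow> node \<Rightarrow> real" where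
  "D_dir N \<xi> I u l = (\<Sum>k=0..N. D_mat N \<xi> (idx l I) k * u (set_idx l I k))"

text \<open>The element is \<open>cbox xL xR\<close>.\<close>

definition dx :: "real^2 \<Rightarrow> real^2 \<Rightarrow> 2 \<Rightarrow> real" where
  "dx xL xR I = xR $ I - xL $ I"

definition J_elem :: "real^2 \<Rightarrow> real^2 \<Rightarrow> real" where
  "J_elem xL xR = dx xL xR 1 * dx xL xR 2 / 4"

definition area :: "real^2 \<Rightarrow> real^2 \<Rightarrow> real" where
  "area xL xR = 4 * J_elem xL xR"

definition kap :: "real^2 \<Rightarrow> real^2 \<Rightarrow> 2 \<Rightarrow> real" where
  "kap xL xR I = 2 / dx xL xR I"

definition node_pos :: "(nat \<Rightarrow> real) \<Rightarrow> real^2 \<Rightarrow> real^2 \<Rightarrow> node \<Rightarrow> real^2" where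
  "node_pos \<xi> xL xR l = (\<chi> I. (xL $ I + xR $ I) / 2 + dx xL xR I / 2 * \<xi> (idx l I))"

text \<open>A face is given by its normal direction and by whether its outward normal is the positive
  (\<open>True\<close>) or negative (\<open>False\<close>) coordinate direction.\<close>

type_synonym face = "2 \<times> bool"

definition eps :: "face \<Rightarrow> real" where
  "eps f = (if snd f then 1 else -1)"

definition normal :: "face \<Rightarrow> real^2" where
  "normal f = eps f *\<^sub>R axis (fst f) 1"

definition J_face :: "real^2 \<Rightarrow> real^2 \<Rightarrow> face \<Rightarrow> real" where
  "J_face xL xR f = J_elem xL xR * kap xL xR (fst f)"

definition vol_node :: "nat \<Rightarrow> face \<Rightarrow> nat \<Rightarrow> node" where
  "vol_node N f q = (let e = (if snd f then N else 0) in if fst f = 1 then (e, q) else (q, e))"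

definition normal_flux :: "real \<Rightarrow> geometry \<Rightarrow> real \<Rightarrow> real^2 \<Rightarrow> state \<Rightarrow> state" where
  "normal_flux \<Gamma> g c n W = (\<Sum>I\<in>UNIV. n $ I *\<^sub>R flux \<Gamma> g c I W)"

text \<open>Interior data \<open>(gm, cm, Wm)\<close> and exterior data \<open>(gp, cp, Wp)\<close> consist of the geometry, the
  weight and the evolved state.\<close>

definition LLF :: "real \<Rightarrow> real^2 \<Rightarrow> real \<Rightarrow> geometry \<Rightarrow> real \<Rightarrow> state \<Rightarrow>
    geometry \<Rightarrow> real \<Rightarrow> state \<Rightarrow> state" where
  "LLF \<Gamma> n a gm cm Wm gp cp Wp =
     (1/2) *\<^sub>R (normal_flux \<Gamma> gm cm n Wm + normal_flux \<Gamma> gp cp n Wp) - (a/2) *\<^sub>R (Wp - Wm)"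

section \<open>Discrete source and source escape rate\<close>

text \<open>\<open>geo\<close>, \<open>w\<close> and \<open>W\<close> are the nodal values of geometry, weight and evolved state.\<close>

definition discrete_source :: "real \<Rightarrow> nat \<Rightarrow> (nat \<Rightarrow> real) \<Rightarrow> real^2 \<Rightarrow> real^2 \<Rightarrow>
    (node \<Rightarrow> geometry) \<Rightarrow> (node \<Rightarrow> real) \<Rightarrow> (node \<Rightarrow> state) \<Rightarrow> node \<Rightarrow> state" where
  "discrete_source \<Gamma> N \<xi> xL xR geo w W l =
     (let U = fluid_state (geo l) (w l) (W l); B = source_coeffs \<Gamma> U (geo l) in
      \<Sum>I\<in>UNIV. kap xL xR I *\<^sub>R
        ((w l * D_dir N \<xi> I (\<lambda>k. j2 (geo k)) l) *\<^sub>R B Vj2 I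
         + (\<Sum>y\<in>AC_vars. D_dir N \<xi> I (\<lambda>k. w k * gval (geo k) y) l *\<^sub>R B y I)
         + D_dir N \<xi> I w l *\<^sub>R R_weight \<Gamma> U (geo l) I))"

definition escape_rate :: "state \<Rightarrow> state \<Rightarrow> real" where
  "escape_rate W S = (if S \<in> closure adm_cone then 0
     else (THE r. r > 0 \<and> (\<forall>t. 0 \<le> t \<and> t < 1 / r \<longrightarrow> W + t *\<^sub>R S \<in> adm_cone) \<and>
                  W + (1 / r) *\<^sub>R S \<in> frontier adm_cone))"

text \<open>Tensor-product cell average of a nodal field.\<close>

definition cell_average :: "nat \<Rightarrow> (nat \<Rightarrow> real) \<Rightarrow> (node \<Rightarrow> state) \<Rightarrow> state" where
  "cell_average N \<omega> X = (1/4) *\<^sub>R (\<Sum>l\<in>vol_nodes N. (\<omega> (fst l) * \<omega> (snd l)) *\<^sub>R X l)"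

end

theory Submission
  imports Defs
begin

text \<open>
  The admissible set is an open convex cone, so the update stays in it once it is written as a sum of
  positive multiples of admissible vectors. Let \<open>W\<^sup>-\<close> be the interior state at a face node with
  dissipation speed \<open>a\<close>, and \<open>H\<^sup>-\<close>, \<open>H\<^sup>+\<close> the normal fluxes of the two traces. The numerical flux
  satisfies

  \<open>a W\<^sup>- - LLF = (1/2) (a W\<^sup>- - H\<^sup>-) + (1/2) (a W\<^sup>+ - H\<^sup>+)\<close>.

  The two terms on the right are admissible as soon as \<open>a\<close> is at least the causal speed
  (\<open>flux_split\<close>, \<open>LLF_split\<close>). The negative face contributions that remain are multiples
  of the interior states \<open>W\<^sup>-\<close>. Sorted by volume nodes (\<open>face_sum_regroup\<close>) they reduce the
  coefficient of the node state \<open>W\<close> from \<open>1\<close> to some \<open>c\<close>, and the time step condition is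
  exactly \<open>\<Delta>t \<lambda>\<^sub>S < c\<close>. By the meaning of the escape rate \<open>\<lambda>\<^sub>S\<close> this keeps \<open>c W + \<Delta>t S\<close>
  admissible (\<open>source_step_in_adm_cone\<close>).

  Admissibility of \<open>a W - H\<close> reduces to the special relativistic statement that \<open>U - F\<^sub>e\<close>
  is admissible for every unit vector \<open>e\<close>, where \<open>F\<^sub>e\<close> is the fluid flux in direction \<open>e\<close>
  (\<open>fluid_flux_split\<close>). In the orthonormal frame the normal direction is a column of the
  triangular matrix \<open>\<Theta>\<close>, whose length is \<open>sqrt \<gamma>\<^sup>I\<^sup>I\<close> because \<open>\<Theta>\<^sup>T \<Theta>\<close> is the inverse spatial metric,
  and the shift only adds a multiple of \<open>U\<close> bounded by \<open>\<bar>\<beta>\<^sup>I\<bar>\<close>. In primitive variables the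
  statement about \<open>U - F\<^sub>e\<close> is an explicit computation that rests on \<open>\<Gamma> / (\<Gamma> - 1) \<ge> 2\<close>; that
  admissible states do have primitive variables is proved by an intermediate value argument for the
  pressure (\<open>cons_of_prim_onto\<close>).
\<close>

section \<open>The admissible cone as an open convex cone\<close>

text \<open>Since \<^const>\<open>R_fun\<close> is the norm of the pair \<open>(D, m)\<close>, the admissible set is the part \<open>D > 0\<close> of the
  open epigraph of a norm. Stability under sums is then the triangle inequality, and stability under
  positive scaling is homogeneity of the norm.\<close>

lemma adm_cone_iff: "(D, m, E) \<in> adm_cone \<longleftrightarrow> D > 0 \<and> norm (D, m) < E"
  by (simp add: adm_cone_def q_fun_def R_fun_def norm_Pair)

lemma adm_cone_add:
  assumes "x \<in> adm_cone" "y \<in> adm_cone"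
  shows "x + y \<in> adm_cone"
proof -
  obtain D m E D' m' E' where xy: "x = (D, m, E)" "y = (D', m', E')"
    by (metis prod_cases3)
  have "norm ((D, m) + (D', m')) \<le> norm (D, m) + norm (D', m')"
    by (rule norm_triangle_ineq)
  then show ?thesis
    using assms unfolding xy by (simp add: adm_cone_iff)
qed

lemma adm_cone_scale:
  assumes "x \<in> adm_cone" "c > 0"
  shows "c *\<^sub>R x \<in> adm_cone"
proof -
  obtain D m E where x: "x = (D, m, E)"
    by (metis prod_cases3)
  have "norm (c *\<^sub>R (D, m)) = c * norm (D, m)"
    using assms(2) by (simp only: norm_scaleR abs_of_pos)
  then show ?thesis
    using assms unfolding x by (simp add: adm_cone_iff)
qed

lemma adm_cone_add_scale:
  assumes "x \<in> adm_cone" "y \<in> adm_cone" "c \<ge> 0"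
  shows "c *\<^sub>R x + y \<in> adm_cone"
  using assms adm_cone_add adm_cone_scale by (cases "c = 0") auto

lemma adm_cone_sum:
  assumes "finite A" "A \<noteq> {}" "\<And>i. i \<in> A \<Longrightarrow> f i \<in> adm_cone"
  shows "sum f A \<in> adm_cone"
  using assms by (induction A rule: finite_ne_induct) (auto intro: adm_cone_add)

lemma open_adm_cone: "open adm_cone"
proof -
  have eq: "adm_cone = {Z. 0 < fst Z} \<inter> {Z. norm (fst Z, fst (snd Z)) < snd (snd Z)}"
    by (auto simp: adm_cone_iff)
  show ?thesis
    unfolding eq by (intro open_Int open_Collect_less continuous_intros)
qed

text \<open>Around an interior point \<open>x\<close> there is room to absorb the error made when \<open>y\<close> is replaced by a
  nearby point of the cone itself. This covers sources on the boundary of the cone, for which the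
  escape rate is zero.\<close>

lemma adm_cone_add_closure:
  assumes "x \<in> adm_cone" "y \<in> closure adm_cone"
  shows "x + y \<in> adm_cone"
proof -
  obtain e where e: "e > 0" "ball x e \<subseteq> adm_cone"
    using open_adm_cone assms(1) open_contains_ball by blast
  obtain y' where y': "y' \<in> adm_cone" "dist y' y < e"
    using assms(2) e(1) closure_approachable by blast
  have "x + (y - y') \<in> ball x e"
    using y'(2) by (simp add: dist_norm norm_minus_commute)
  then have "x + (y - y') \<in> adm_cone"
    using e(2) by blast
  from adm_cone_add[OF this y'(1)] show ?thesis by simp
qed

section \<open>The source escape rate\<close>

text \<open>Dividing \<open>W + t S\<close> by \<open>t\<close> and letting \<open>t\<close> grow shows that the direction of a ray contained in a
  cone lies in the closure of the cone.\<close>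

lemma ray_leaves_adm_cone:
  assumes "S \<notin> closure adm_cone"
  shows "\<exists>t\<ge>0. W + t *\<^sub>R S \<notin> adm_cone"
proof (rule ccontr)
  assume "\<not> ?thesis"
  then have ray: "W + t *\<^sub>R S \<in> adm_cone" if "t \<ge> 0" for t
    using that by blast
  have "(1 / real (Suc n)) *\<^sub>R W + S \<in> adm_cone" for n
    using adm_cone_scale[OF ray[of "real (Suc n)"], of "1 / real (Suc n)"]
    by (simp add: scaleR_add_right del: of_nat_Suc)
  moreover have "(\<lambda>n. (1 / real (Suc n)) *\<^sub>R W + S) \<longlonglongrightarrow> 0 *\<^sub>R W + S"
    using LIMSEQ_inverse_real_of_nat by (intro tendsto_intros) (simp add: inverse_eq_divide)
  ultimately have "S \<in> closure adm_cone"
    unfolding closure_sequential by fastforce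
  with assms show False by contradiction
qed

text \<open>The exit time \<open>T\<close> is the smallest \<open>t \<ge> 0\<close> for which \<open>W + t S\<close> is outside the cone. It is attained
  because the cone is open, and positive because \<open>W\<close> is inside.\<close>

lemma escape_time_exists:
  assumes W: "W \<in> adm_cone" and S: "S \<notin> closure adm_cone"
  obtains T where "T > 0" "\<And>t. 0 \<le> t \<Longrightarrow> t < T \<Longrightarrow> W + t *\<^sub>R S \<in> adm_cone"
    "W + T *\<^sub>R S \<in> frontier adm_cone"
proof -
  define A where "A = {0..} \<inter> (\<lambda>t. W + t *\<^sub>R S) -` (- adm_cone)"
  define T where "T = Inf A"
  have ne: "A \<noteq> {}"
    using ray_leaves_adm_cone[OF S, of W] by (auto simp: A_def)
  have bdd: "bdd_below A"
    by (rule bdd_belowI[of _ 0]) (simp add: A_def)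
  have "closed A"
    unfolding A_def
    by (intro closed_Int closed_vimage continuous_intros) (auto intro: open_adm_cone)
  then have TA: "T \<in> A"
    unfolding T_def using closed_contains_Inf ne bdd by blast
  then have out: "W + T *\<^sub>R S \<notin> adm_cone" and "T \<noteq> 0" "T \<ge> 0"
    using W by (auto simp: A_def)
  then have T: "T > 0" by simp
  have inside: "W + t *\<^sub>R S \<in> adm_cone" if "0 \<le> t" "t < T" for t
    using cInf_lower[OF _ bdd, of t] that by (auto simp: A_def T_def)
  have "(\<lambda>t. W + t *\<^sub>R S) ` closure {0..<T} \<subseteq> closure adm_cone"
    by (rule image_closure_subset)
      (use inside in \<open>auto intro!: continuous_intros closure_subset[THEN subsetD]\<close>)
  moreover have "W + T *\<^sub>R S \<in> (\<lambda>t. W + t *\<^sub>R S) ` closure {0..<T}"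
    using T by (intro imageI) simp
  ultimately have "W + T *\<^sub>R S \<in> closure adm_cone"
    by blast
  with out have "W + T *\<^sub>R S \<in> frontier adm_cone"
    using open_adm_cone by (simp add: frontier_def interior_open)
  with T inside that show ?thesis by blast
qed

text \<open>The description defining \<^const>\<open>escape_rate\<close> has exactly one solution, the reciprocal of the exit
  time: a smaller \<open>1 / r\<close> would put a frontier point into the open cone, and a larger one would keep
  the ray inside at the exit time.\<close>

lemma escape_rate_spec:
  assumes W: "W \<in> adm_cone" and S: "S \<notin> closure adm_cone"
  shows "escape_rate W S > 0"
    and "\<And>t. 0 \<le> t \<Longrightarrow> t < 1 / escape_rate W S \<Longrightarrow> W + t *\<^sub>R S \<in> adm_cone"
proof -
  obtain T where T: "T > 0" "\<And>t. 0 \<le> t \<Longrightarrow> t < T \<Longrightarrow> W + t *\<^sub>R S \<in> adm_cone"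
    "W + T *\<^sub>R S \<in> frontier adm_cone"
    using escape_time_exists[OF W S] by metis
  have disj: "Z \<notin> adm_cone" if "Z \<in> frontier adm_cone" for Z
    using that open_adm_cone by (simp add: frontier_def interior_open)
  have "escape_rate W S = 1 / T"
    unfolding escape_rate_def if_not_P[OF S]
  proof (rule the_equality)
    show "1 / T > 0 \<and> (\<forall>t. 0 \<le> t \<and> t < 1 / (1 / T) \<longrightarrow> W + t *\<^sub>R S \<in> adm_cone) \<and>
      W + (1 / (1 / T)) *\<^sub>R S \<in> frontier adm_cone"
      using T by simp
  next
    fix r assume r: "r > 0 \<and> (\<forall>t. 0 \<le> t \<and> t < 1 / r \<longrightarrow> W + t *\<^sub>R S \<in> adm_cone) \<and>
      W + (1 / r) *\<^sub>R S \<in> frontier adm_cone"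
    then have "\<not> 1 / r < T" "\<not> T < 1 / r"
      using T disj by (metis less_eq_real_def zero_less_divide_1_iff, metis less_eq_real_def)
    then have "1 / r = T" by simp
    then show "r = 1 / T" using r by auto
  qed
  with T show "escape_rate W S > 0"
    and "\<And>t. 0 \<le> t \<Longrightarrow> t < 1 / escape_rate W S \<Longrightarrow> W + t *\<^sub>R S \<in> adm_cone"
    by auto
qed

text \<open>The part \<open>c W\<close> of a node state which remains after the fluxes have taken their share can carry the
  source, since \<open>c W + t S = c (W + (t / c) S)\<close> and \<open>t / c\<close> is below the exit time. The
  escape rate is never negative, so the hypothesis forces \<open>c > 0\<close>.\<close>

lemma source_step_in_adm_cone:
  assumes W: "W \<in> adm_cone" and t: "t > 0" and c: "t * escape_rate W S < c"
  shows "c *\<^sub>R W + t *\<^sub>R S \<in> adm_cone"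
proof (cases "S \<in> closure adm_cone")
  case True
  then have "c > 0"
    using c by (simp add: escape_rate_def)
  have "(c / t) *\<^sub>R W + S \<in> adm_cone"
    using W True \<open>c > 0\<close> t by (intro adm_cone_add_closure adm_cone_scale) auto
  from adm_cone_scale[OF this t] show ?thesis
    using t by (simp add: scaleR_add_right)
next
  case False
  note rate = escape_rate_spec[OF W False]
  have "c > 0"
    using c rate(1) t by (smt (verit) mult_pos_pos)
  have "t / c < 1 / escape_rate W S"
    using c rate(1) \<open>c > 0\<close> by (simp add: field_simps)
  then have "W + (t / c) *\<^sub>R S \<in> adm_cone"
    using rate(2) t \<open>c > 0\<close> by simp
  from adm_cone_scale[OF this \<open>c > 0\<close>] show ?thesis
    using \<open>c > 0\<close> by (simp add: scaleR_add_right)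
qed

section \<open>Recovery of primitive variables\<close>

lemma norm_lt_one_power2: "norm v < 1 \<Longrightarrow> (norm v)\<^sup>2 < 1"
  by (simp add: abs_square_less_1)

lemma lorentz_power2:
  assumes "norm v < 1"
  shows "(lorentz v)\<^sup>2 * (1 - (norm v)\<^sup>2) = 1"
  using norm_lt_one_power2[OF assms] by (simp add: lorentz_def power_divide)

lemma lorentz_ge_one:
  assumes "norm v < 1"
  shows "lorentz v \<ge> 1"
  using norm_lt_one_power2[OF assms] by (simp add: lorentz_def le_divide_eq)

text \<open>This is the only form in which the range of the adiabatic index enters.\<close>

lemma adiabatic_ratio_ge_two:
  fixes \<Gamma> :: real
  assumes "1 < \<Gamma>" "\<Gamma> \<le> 2"
  shows "\<Gamma> / (\<Gamma> - 1) \<ge> 2"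
  using assms by (simp add: field_simps)

lemma mult_enthalpy:
  assumes "\<rho> > 0"
  shows "\<rho> * enthalpy \<Gamma> \<rho> p = \<rho> + \<Gamma> / (\<Gamma> - 1) * p"
  using assms by (simp add: enthalpy_def distrib_left)

text \<open>The flux is written through \<^const>\<open>prim_of_cons\<close>, an arbitrary choice of preimage, and surjectivity
  makes every such choice a genuine one. For a given pressure \<open>p\<close> the momentum fixes the
  velocity \<open>m / (E + p)\<close> and the density \<open>D / L\<close>. The remaining energy relation is
  \<open>f p = E + p - D L - g p L\<^sup>2 = 0\<close> with \<open>g = \<Gamma> / (\<Gamma> - 1)\<close>. Positivity of \<open>f 0\<close> is the
  cone condition, \<open>g \<ge> 2\<close> makes \<open>f\<close> nonpositive for large \<open>p\<close>, and the intermediate value theorem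
  gives a positive root.\<close>

lemma cons_of_prim_onto:
  assumes \<Gamma>: "1 < \<Gamma>" "\<Gamma> \<le> 2" and U: "(D, m, E) \<in> adm_cone"
  obtains P where "P \<in> prim_set" "cons_of_prim \<Gamma> P = (D, m, E)"
proof -
  define g where "g = \<Gamma> / (\<Gamma> - 1)"
  have g: "g \<ge> 2"
    unfolding g_def by (rule adiabatic_ratio_ge_two[OF \<Gamma>])
  have D: "D > 0" and R: "sqrt (D\<^sup>2 + (norm m)\<^sup>2) < E"
    using U by (simp_all add: adm_cone_iff norm_Pair)
  have "0 \<le> sqrt (D\<^sup>2 + (norm m)\<^sup>2)" by simp
  then have E: "E > 0" using R by linarith
  have DE: "D\<^sup>2 + (norm m)\<^sup>2 < E\<^sup>2"
  proof -
    have "sqrt (D\<^sup>2 + (norm m)\<^sup>2) < sqrt (E\<^sup>2)"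
      using R E by simp
    then show ?thesis by (simp only: real_sqrt_less_iff)
  qed
  have mE: "norm m < E"
    using DE E by (smt (verit) power2_less_imp_less zero_le_power2)
  define v where "v = (\<lambda>p. (1 / (E + p)) *\<^sub>R m)"
  have v1: "norm (v p) < 1" if "p \<ge> 0" for p
    using that E mE by (simp add: v_def)
  define f where "f = (\<lambda>p. E + p - D * lorentz (v p) - g * p * (lorentz (v p))\<^sup>2)"
  have cont_v: "continuous_on {0..E + 1} v"
    unfolding v_def using E by (intro continuous_intros) auto
  have "sqrt (1 - (norm (v p))\<^sup>2) \<noteq> 0" if "p \<in> {0..E + 1}" for p
    using norm_lt_one_power2[OF v1, of p] that by simp
  then have cont: "continuous_on {0..E + 1} f"
    unfolding f_def lorentz_def by (intro continuous_intros cont_v) auto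
  have f0: "f 0 \<ge> 0" "f 0 \<noteq> 0"
  proof -
    let ?s = "sqrt (1 - (norm (v 0))\<^sup>2)"
    have "1 - (norm (v 0))\<^sup>2 = (E\<^sup>2 - (norm m)\<^sup>2) / E\<^sup>2"
      using E by (simp add: v_def power_divide field_simps)
    also have "\<dots> > (D / E)\<^sup>2"
      using DE E by (simp add: power_divide divide_strict_right_mono)
    finally have "D / E < ?s"
      by (rule real_less_rsqrt)
    then have "D / ?s < E"
      using D E by (smt (verit) divide_less_eq divide_pos_pos mult.commute pos_divide_less_eq)
    then show "f 0 \<ge> 0" "f 0 \<noteq> 0" by (simp_all add: f_def lorentz_def)
  qed
  \<comment> \<open>With \<open>L \<ge> 1\<close> one has \<open>f p \<le> E - p\<close>, so every \<open>p \<ge> E\<close> serves as the right end point.\<close>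
  have f1: "f (E + 1) \<le> 0"
  proof -
    let ?L = "lorentz (v (E + 1))"
    have L: "?L \<ge> 1" using v1 E by (intro lorentz_ge_one) auto
    then have "?L\<^sup>2 \<ge> 1" by simp
    then have "2 * (E + 1) * 1 \<le> g * (E + 1) * ?L\<^sup>2"
      using g E by (intro mult_mono) auto
    moreover have "D * ?L \<ge> 0" using D L by simp
    ultimately show ?thesis by (simp add: f_def)
  qed
  obtain p where p: "0 \<le> p" "f p = 0"
    using IVT2'[OF f1 f0(1) _ cont] E by auto
  then have p0: "p > 0"
    using f0(2) by (cases "p = 0") auto
  define L where "L = lorentz (v p)"
  have L: "L \<ge> 1"
    unfolding L_def by (intro lorentz_ge_one v1 p)
  have bal: "E + p = D * L + g * p * L\<^sup>2"
    using p(2) by (simp add: f_def L_def)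
  have "D / L * enthalpy \<Gamma> (D / L) p = D / L + g * p"
    unfolding g_def using D L by (intro mult_enthalpy) simp
  then have H: "D / L * enthalpy \<Gamma> (D / L) p * L\<^sup>2 = E + p"
    using bal L by (simp add: power2_eq_square field_simps)
  have "cons_of_prim \<Gamma> (D / L, v p, p) =
      (D / L * L, (E + p) *\<^sub>R v p, E + p - p)"
    unfolding cons_of_prim_def L_def[symmetric] prod.case H ..
  also have "\<dots> = (D, m, E)"
    using L E p0 by (simp add: v_def)
  finally show ?thesis
    using that[of "(D / L, v p, p)"] D L p0 v1[OF p(1)] by (simp add: prim_set_def)
qed

lemma prim_of_cons_inverse:
  assumes "1 < \<Gamma>" "\<Gamma> \<le> 2" and "U \<in> adm_cone"
  shows "prim_of_cons \<Gamma> U \<in> prim_set" "cons_of_prim \<Gamma> (prim_of_cons \<Gamma> U) = U"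
proof -
  have "U \<in> cons_of_prim \<Gamma> ` prim_set"
    using cons_of_prim_onto[OF assms(1,2)] assms(3) by (metis imageI prod_cases3)
  then show "prim_of_cons \<Gamma> U \<in> prim_set" "cons_of_prim \<Gamma> (prim_of_cons \<Gamma> U) = U"
    unfolding prim_of_cons_def by (rule inv_into_into, rule f_inv_into_f)
qed

section \<open>Causal splitting of the fluid flux\<close>

text \<open>The vector is \<open>U - F\<^sub>e\<close>, with \<open>F\<^sub>e\<close> the flux through a surface element of unit normal \<open>e\<close>; its
  admissibility says that no signal outruns light. With \<open>k = 1 - v \<bullet> e > 0\<close> and
  \<open>H = \<rho> h L\<^sup>2\<close> its components are \<open>D k\<close>, \<open>k m - p e\<close> and \<open>H k - p\<close>. When the squares
  of both sides of the cone inequality are compared, \<open>p\<^sup>2\<close> cancels, and so do the terms linear in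
  \<open>k\<close>. What is left is
  \<open>k\<^sup>2 L\<^sup>2 ((\<rho> h)\<^sup>2 - 2 \<rho> h p - \<rho>\<^sup>2)\<close>. Inserting \<open>\<rho> h = \<rho> + g p\<close> gives
  \<open>2 (g - 1) \<rho> p + g (g - 2) p\<^sup>2\<close> for the bracket, which is positive because \<open>g \<ge> 2\<close>.\<close>

lemma prim_flux_split:
  fixes v e :: "real^2"
  assumes \<Gamma>: "1 < \<Gamma>" "\<Gamma> \<le> 2" and P: "(\<rho>, v, p) \<in> prim_set" and e: "norm e = 1"
    and U: "cons_of_prim \<Gamma> (\<rho>, v, p) = (D, m, E)"
  shows "(D * (1 - v \<bullet> e), (1 - v \<bullet> e) *\<^sub>R m - p *\<^sub>R e, E - m \<bullet> e) \<in> adm_cone"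
proof -
  define g where "g = \<Gamma> / (\<Gamma> - 1)"
  define L where "L = lorentz v"
  define h where "h = enthalpy \<Gamma> \<rho> p"
  define H where "H = \<rho> * h * L\<^sup>2"
  define k where "k = 1 - v \<bullet> e"
  have g: "g \<ge> 2"
    unfolding g_def by (rule adiabatic_ratio_ge_two[OF \<Gamma>])
  have \<rho>: "\<rho> > 0" and p: "p > 0" and v: "norm v < 1"
    using P by (simp_all add: prim_set_def)
  have L: "L \<ge> 1" and L2: "L\<^sup>2 * (1 - (norm v)\<^sup>2) = 1"
    unfolding L_def using lorentz_ge_one[OF v] lorentz_power2[OF v] by auto
  have D: "D = \<rho> * L" and m: "m = H *\<^sub>R v" and E: "E = H - p"
    using U by (simp_all add: cons_of_prim_def H_def h_def L_def)
  have \<rho>h: "\<rho> * h = \<rho> + g * p"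
    unfolding h_def g_def by (rule mult_enthalpy[OF \<rho>])
  have gp: "g * p \<ge> 2 * p"
    using g p by simp
  have H0: "H > 0"
    using \<rho>h \<rho> p g L by (simp add: H_def add_pos_pos)
  have "v \<bullet> e \<le> norm v * norm e"
    by (rule norm_cauchy_schwarz)
  then have k: "k \<ge> 1 - norm v" and k0: "k > 0"
    using e v by (simp_all add: k_def)
  \<comment> \<open>The smallest possible \<open>k\<close> is \<open>1 - norm v\<close>, for which \<open>H k = \<rho> h / (1 + norm v) > \<rho> h / 2 > p\<close>.\<close>
  have energy: "H * k - p > 0"
  proof -
    have "H * (1 - norm v) * (1 + norm v) = \<rho> * h * (L\<^sup>2 * (1 - (norm v)\<^sup>2))"
      by (simp add: H_def power2_eq_square algebra_simps)
    then have "H * (1 - norm v) * (1 + norm v) = \<rho> * h"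
      by (simp add: L2)
    moreover have "H * (1 - norm v) * (1 + norm v) \<le> H * (1 - norm v) * 2"
      using H0 v by (intro mult_left_mono) auto
    moreover have "H * (1 - norm v) \<le> H * k"
      using H0 k by simp
    ultimately show ?thesis
      using \<rho>h gp \<rho> by linarith
  qed
  have ve: "v \<bullet> e = 1 - k" by (simp add: k_def)
  have "(norm (k *\<^sub>R m - p *\<^sub>R e))\<^sup>2 = (H * k)\<^sup>2 * (norm v)\<^sup>2 - 2 * (H * k * p * (1 - k)) + p\<^sup>2 * (norm e)\<^sup>2"
    unfolding power2_norm_eq_inner m ve[symmetric]
    by (simp add: inner_diff inner_commute power2_eq_square algebra_simps)
  also have "\<dots> = (H * k)\<^sup>2 * (norm v)\<^sup>2 - 2 * (H * k * p * (1 - k)) + p\<^sup>2"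
    by (simp add: e)
  finally have mom: "(norm (k *\<^sub>R m - p *\<^sub>R e))\<^sup>2 =
    (H * k)\<^sup>2 * (norm v)\<^sup>2 - 2 * (H * k * p * (1 - k)) + p\<^sup>2" .
  have HL: "H\<^sup>2 * (1 - (norm v)\<^sup>2) = L\<^sup>2 * (\<rho> * h)\<^sup>2"
  proof -
    have "H\<^sup>2 * (1 - (norm v)\<^sup>2) = L\<^sup>2 * (\<rho> * h)\<^sup>2 * (L\<^sup>2 * (1 - (norm v)\<^sup>2))"
      by (simp add: H_def power_mult_distrib power2_eq_square)
    then show ?thesis using L2 by simp
  qed
  have "(H * k - p)\<^sup>2 - (D * k)\<^sup>2 - (norm (k *\<^sub>R m - p *\<^sub>R e))\<^sup>2 =
      k\<^sup>2 * (H\<^sup>2 * (1 - (norm v)\<^sup>2) - 2 * H * p - D\<^sup>2)"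
    unfolding mom by (simp add: power2_eq_square algebra_simps)
  also have "\<dots> = (k * L)\<^sup>2 * ((\<rho> * h)\<^sup>2 - 2 * (\<rho> * h) * p - \<rho>\<^sup>2)"
    unfolding HL D by (simp add: H_def power2_eq_square algebra_simps)
  also have "(\<rho> * h)\<^sup>2 - 2 * (\<rho> * h) * p - \<rho>\<^sup>2 = 2 * (g - 1) * \<rho> * p + g * (g - 2) * p\<^sup>2"
    unfolding \<rho>h by (simp add: power2_eq_square algebra_simps)
  finally have gap: "(H * k - p)\<^sup>2 - (D * k)\<^sup>2 - (norm (k *\<^sub>R m - p *\<^sub>R e))\<^sup>2 =
      (k * L)\<^sup>2 * (2 * (g - 1) * \<rho> * p + g * (g - 2) * p\<^sup>2)" .
  have "2 * (g - 1) * \<rho> * p > 0" "g * (g - 2) * p\<^sup>2 \<ge> 0" "(k * L)\<^sup>2 > 0"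
    using g \<rho> p k0 L by auto
  then have "(k * L)\<^sup>2 * (2 * (g - 1) * \<rho> * p + g * (g - 2) * p\<^sup>2) > 0"
    by (intro mult_pos_pos) auto
  with gap have "(D * k)\<^sup>2 + (norm (k *\<^sub>R m - p *\<^sub>R e))\<^sup>2 < (H * k - p)\<^sup>2"
    by linarith
  then have "norm (D * k, k *\<^sub>R m - p *\<^sub>R e) < H * k - p"
    using energy by (simp add: norm_Pair real_less_lsqrt)
  moreover have "E - m \<bullet> e = H * k - p"
    by (simp add: E m k_def algebra_simps)
  moreover have "D * k > 0"
    using \<rho> L k0 by (simp add: D)
  ultimately show ?thesis
    by (simp add: adm_cone_iff k_def)
qed

lemma fluid_flux_split:
  fixes e :: "real^2"
  assumes \<Gamma>: "1 < \<Gamma>" "\<Gamma> \<le> 2" and U: "U \<in> adm_cone" and e: "norm e = 1"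
  shows "U - (\<Sum>a\<in>UNIV. e $ a *\<^sub>R fluid_flux \<Gamma> a U) \<in> adm_cone"
proof -
  obtain D m E where Ueq: "U = (D, m, E)" by (metis prod_cases3)
  obtain \<rho> v p where P: "prim_of_cons \<Gamma> U = (\<rho>, v, p)" by (metis prod_cases3)
  have "U - (\<Sum>a\<in>UNIV. e $ a *\<^sub>R fluid_flux \<Gamma> a U) =
      (D * (1 - v \<bullet> e), (1 - v \<bullet> e) *\<^sub>R m - p *\<^sub>R e, E - m \<bullet> e)"
    using P unfolding Ueq
    by (simp add: fluid_flux_def sum_2 inner_vec_def vec_eq_iff forall_2 axis_def algebra_simps)
  then show ?thesis
    using prim_flux_split[OF \<Gamma> _ e, of \<rho> v p D m E] prim_of_cons_inverse[OF \<Gamma> U] P Ueq by simp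
qed

section \<open>The triangular frame\<close>

lemma matrix_inv_right_inverse: "invertible A \<Longrightarrow> A ** matrix_inv A = mat 1"
  unfolding invertible_def matrix_inv_def by (rule someI2_ex) blast+

lemma matrix_inv_spd:
  fixes G :: "real^'n^'n"
  assumes sym: "transpose G = G" and pos: "\<And>u. u \<noteq> 0 \<Longrightarrow> u \<bullet> (G *v u) > 0"
  shows "transpose (matrix_inv G) = matrix_inv G"
    and "\<And>u. u \<noteq> 0 \<Longrightarrow> u \<bullet> (matrix_inv G *v u) > 0"
proof -
  have "u = 0" if "G *v u = 0" for u
    using pos[of u] that by force
  then have inv: "invertible G"
    using matrix_left_invertible_ker[of G] by (auto simp: invertible_left_inverse)
  have "transpose (matrix_inv G) ** G = mat 1"
    using inv sym by (metis matrix_inv_right_inverse matrix_transpose_mul transpose_mat)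
  then show "transpose (matrix_inv G) = matrix_inv G"
    using inv by (metis matrix_inv_right_inverse matrix_mul_assoc matrix_mul_lid matrix_mul_rid)
  fix u :: "real^'n" assume u: "u \<noteq> 0"
  let ?y = "matrix_inv G *v u"
  have Gy: "G *v ?y = u"
    using inv by (simp add: matrix_vector_mul_assoc matrix_inv_right_inverse)
  then have "?y \<noteq> 0" using u by auto
  from pos[OF this] show "u \<bullet> ?y > 0"
    unfolding Gy by (simp add: inner_commute)
qed

text \<open>Comparing entries determines \<open>T\<close> successively as \<open>T\<^sub>1\<^sub>1 = sqrt M\<^sub>1\<^sub>1\<close>,
  \<open>T\<^sub>1\<^sub>2 = M\<^sub>1\<^sub>2 / T\<^sub>1\<^sub>1\<close> and \<open>T\<^sub>2\<^sub>2 = sqrt (M\<^sub>2\<^sub>2 - T\<^sub>1\<^sub>2\<^sup>2)\<close>. The radicands are positive because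
  \<open>M\<^sub>1\<^sub>1\<close> and the determinant are. This is what makes the definite description
  of \<^const>\<open>theta\<close> denote the intended matrix.\<close>

lemma cholesky_2:
  fixes M :: "real^2^2"
  assumes sym: "transpose M = M" and pos: "\<And>u. u \<noteq> 0 \<Longrightarrow> u \<bullet> (M *v u) > 0"
  shows "\<exists>!T :: real^2^2. T $ 2 $ 1 = 0 \<and> T $ 1 $ 1 > 0 \<and> T $ 2 $ 2 > 0 \<and> transpose T ** T = M"
proof -
  have M21: "M $ 2 $ 1 = M $ 1 $ 2"
    using arg_cong[OF sym, of "\<lambda>A. A $ 1 $ 2"] by (simp add: transpose_def)
  have quad: "M $ 1 $ 1 * x\<^sup>2 + 2 * M $ 1 $ 2 * x * y + M $ 2 $ 2 * y\<^sup>2 > 0" if "x \<noteq> 0 \<or> y \<noteq> 0" for x y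
    using pos[of "vector [x, y]"] that M21
    by (simp add: vec_eq_iff forall_2 inner_vec_def matrix_vector_mult_def sum_2
        power2_eq_square algebra_simps)
  have M11: "M $ 1 $ 1 > 0"
    using quad[of 1 0] by simp
  \<comment> \<open>The test vector \<open>(- M\<^sub>1\<^sub>2, M\<^sub>1\<^sub>1)\<close> turns the quadratic form into \<open>M\<^sub>1\<^sub>1\<close> times the determinant.\<close>
  have "M $ 1 $ 1 * (M $ 1 $ 1 * M $ 2 $ 2 - (M $ 1 $ 2)\<^sup>2) > 0"
    using quad[of "- M $ 1 $ 2" "M $ 1 $ 1"] M11 by (simp add: power2_eq_square algebra_simps)
  then have det: "M $ 1 $ 1 * M $ 2 $ 2 - (M $ 1 $ 2)\<^sup>2 > 0"
    using M11 by (simp add: zero_less_mult_iff)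
  define a where "a = sqrt (M $ 1 $ 1)"
  define b where "b = M $ 1 $ 2 / a"
  define c where "c = sqrt (M $ 2 $ 2 - b\<^sup>2)"
  have a: "a > 0" "a * a = M $ 1 $ 1"
    using M11 by (simp_all add: a_def)
  have "b\<^sup>2 < M $ 2 $ 2"
    using det a M11 by (simp add: b_def power_divide power2_eq_square divide_less_eq mult.commute)
  then have c: "c > 0" "c * c = M $ 2 $ 2 - b\<^sup>2"
    by (simp_all add: c_def)
  have ab: "a * b = M $ 1 $ 2"
    using a by (simp add: b_def)
  have char: "transpose T ** T = M \<longleftrightarrow>
      T $ 1 $ 1 * T $ 1 $ 1 = M $ 1 $ 1 \<and> T $ 1 $ 1 * T $ 1 $ 2 = M $ 1 $ 2 \<and>
      T $ 1 $ 2 * T $ 1 $ 2 + T $ 2 $ 2 * T $ 2 $ 2 = M $ 2 $ 2"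
    if "T $ 2 $ 1 = 0" for T :: "real^2^2"
    using that M21
    by (auto simp: vec_eq_iff forall_2 matrix_matrix_mult_def transpose_def sum_2 mult.commute)
  define T0 :: "real^2^2" where "T0 = vector [vector [a, b], vector [0, c]]"
  show ?thesis
  proof (rule ex1I[of _ T0])
    show "T0 $ 2 $ 1 = 0 \<and> T0 $ 1 $ 1 > 0 \<and> T0 $ 2 $ 2 > 0 \<and> transpose T0 ** T0 = M"
      using a c ab by (simp add: char T0_def power2_eq_square)
  next
    fix T :: "real^2^2"
    assume T: "T $ 2 $ 1 = 0 \<and> T $ 1 $ 1 > 0 \<and> T $ 2 $ 2 > 0 \<and> transpose T ** T = M"
    then have eqs: "T $ 1 $ 1 * T $ 1 $ 1 = M $ 1 $ 1" "T $ 1 $ 1 * T $ 1 $ 2 = M $ 1 $ 2"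
      "T $ 1 $ 2 * T $ 1 $ 2 + T $ 2 $ 2 * T $ 2 $ 2 = M $ 2 $ 2"
      using char by auto
    have "T $ 1 $ 1 = a"
      using eqs(1) T by (simp add: a_def real_sqrt_unique power2_eq_square)
    moreover from this have "T $ 1 $ 2 = b"
      using eqs(2) a by (simp add: b_def field_simps)
    moreover from this have "T $ 2 $ 2 = c"
      using eqs(3) T unfolding c_def
      by (intro real_sqrt_unique[symmetric]) (auto simp: power2_eq_square)
    ultimately show "T = T0"
      using T by (simp add: vec_eq_iff forall_2 T0_def)
  qed
qed

text \<open>The columns of the frame have the lengths that occur in the causal speed; dividing by these lengths
  produces the unit normals to which the causal splitting applies.\<close>

lemma theta_column:
  assumes sym: "transpose (gam g) = gam g" and pos: "\<And>u. u \<noteq> 0 \<Longrightarrow> u \<bullet> (gam g *v u) > 0"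
  shows "(norm (column I (theta g)))\<^sup>2 = matrix_inv (gam g) $ I $ I"
    and "matrix_inv (gam g) $ I $ I > 0"
proof -
  have "transpose (theta g) ** theta g = matrix_inv (gam g)"
    using theI'[OF cholesky_2[OF matrix_inv_spd(1,2)[OF sym pos]]]
    unfolding theta_def by blast
  then have "matrix_inv (gam g) $ I $ I = (transpose (theta g) ** theta g) $ I $ I"
    by simp
  also have "\<dots> = (norm (column I (theta g)))\<^sup>2"
    unfolding power2_norm_eq_inner
    by (simp add: matrix_matrix_mult_def transpose_def column_def inner_vec_def)
  finally show "(norm (column I (theta g)))\<^sup>2 = matrix_inv (gam g) $ I $ I" ..
  have "axis I 1 \<bullet> (matrix_inv (gam g) *v axis I 1) > 0"
    by (rule matrix_inv_spd(2)[OF sym pos]) simp_all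
  then show "matrix_inv (gam g) $ I $ I > 0"
    by (simp add: inner_axis' matrix_vector_mult_basis column_def)
qed

lemma j2_pos:
  assumes sym: "transpose (gam g) = gam g" and pos: "\<And>u. u \<noteq> 0 \<Longrightarrow> u \<bullet> (gam g *v u) > 0"
  shows "j2 g > 0"
proof -
  let ?M = "gam g"
  obtain T :: "real^2^2" where T: "T $ 2 $ 1 = 0" "T $ 1 $ 1 > 0" "T $ 2 $ 2 > 0" "transpose T ** T = ?M"
    using cholesky_2[OF sym pos] by blast
  have "det ?M = det T * det T"
    using T(4) by (metis det_mul det_transpose)
  moreover have "det T > 0"
    using T by (simp add: det_2)
  ultimately show ?thesis by (simp add: j2_def)
qed

section \<open>Positivity of the weighted face fluxes\<close>

text \<open>Put \<open>G = sqrt \<gamma>\<^sup>I\<^sup>I\<close>, and let \<open>e\<close> be \<open>s\<close> times the normalized \<open>I\<close>-th column of the frame. After division by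
  \<open>c j\<^sub>2\<close> the expression is \<open>(a - \<alpha> G + s \<beta>\<^sup>I) U + \<alpha> G (U - F\<^sub>e)\<close>. The bound on \<open>a\<close> makes the
  first coefficient nonnegative: the part \<open>\<alpha> G\<close> of the causal speed pays for the fluid flux and the
  part \<open>\<bar>\<beta>\<^sup>I\<bar>\<close> for the transport by the shift.\<close>

lemma flux_split:
  assumes \<Gamma>: "1 < \<Gamma>" "\<Gamma> \<le> 2"
    and lapse: "lapse g > 0" and sym: "transpose (gam g) = gam g"
    and pos: "\<And>u. u \<noteq> 0 \<Longrightarrow> u \<bullet> (gam g *v u) > 0"
    and c: "c > 0" and W: "W \<in> adm_cone" and a: "a \<ge> causal_speed g I"
    and s: "\<bar>s\<bar> = 1"
  shows "a *\<^sub>R W - s *\<^sub>R flux \<Gamma> g c I W \<in> adm_cone"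
proof -
  define U where "U = fluid_state g c W"
  define G where "G = sqrt (matrix_inv (gam g) $ I $ I)"
  define e where "e = (s / G) *\<^sub>R column I (theta g)"
  have cj: "c * j2 g > 0"
    using c j2_pos[OF sym pos] by simp
  have U: "U \<in> adm_cone"
    unfolding U_def fluid_state_def using W cj by (intro adm_cone_scale) auto
  have WU: "W = (c * j2 g) *\<^sub>R U"
    using cj by (auto simp: U_def fluid_state_def)
  have G: "G > 0" "norm (column I (theta g)) = G"
    unfolding G_def using theta_column(2)[OF sym pos, of I]
    by (simp_all flip: theta_column(1)[OF sym pos])
  have e: "norm e = 1"
    using G s by (simp add: e_def)
  have comp: "s * theta g $ i $ I = G * e $ i" for i
    using G by (simp add: e_def column_def)
  have F: "s *\<^sub>R (\<Sum>i\<in>UNIV. (c * A_geo g i I) *\<^sub>R fluid_flux \<Gamma> i U) =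
      (c * j2 g) *\<^sub>R (lapse g * G) *\<^sub>R (\<Sum>i\<in>UNIV. e $ i *\<^sub>R fluid_flux \<Gamma> i U)"
    unfolding scaleR_sum_right scaleR_scaleR A_geo_def
  proof (rule sum.cong[OF refl])
    fix i
    have "s * (c * (lapse g * j2 g * theta g $ i $ I)) = c * j2 g * lapse g * (s * theta g $ i $ I)"
      by simp
    then show "(s * (c * (lapse g * j2 g * theta g $ i $ I))) *\<^sub>R fluid_flux \<Gamma> i U =
        (c * j2 g * (lapse g * G * e $ i)) *\<^sub>R fluid_flux \<Gamma> i U"
      by (simp add: comp)
  qed
  define b where "b = shiftv g $ I"
  have eq: "a *\<^sub>R W - s *\<^sub>R flux \<Gamma> g c I W = (c * j2 g) *\<^sub>R
      ((a - lapse g * G + s * b) *\<^sub>R U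
        + (lapse g * G) *\<^sub>R (U - (\<Sum>i\<in>UNIV. e $ i *\<^sub>R fluid_flux \<Gamma> i U)))"
    unfolding flux_def U_def[symmetric] scaleR_diff_right F
    by (simp add: WU C_geo_def b_def algebra_simps)
  have "\<bar>s * b\<bar> = \<bar>b\<bar>" using s by (simp add: abs_mult)
  then have "a - lapse g * G + s * b \<ge> 0"
    using a unfolding causal_speed_def G_def[symmetric] b_def[symmetric] by linarith
  then show ?thesis
    unfolding eq using G(1) lapse cj
    by (intro adm_cone_scale[OF _ cj] adm_cone_add_scale[OF U] adm_cone_scale
        fluid_flux_split[OF \<Gamma> U e]) auto
qed

lemma normal_flux_eq: "normal_flux \<Gamma> g c (normal f) W = eps f *\<^sub>R flux \<Gamma> g c (fst f) W"
proof -
  have "normal_flux \<Gamma> g c (normal f) W =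
      (\<Sum>I\<in>UNIV. if I = fst f then eps f *\<^sub>R flux \<Gamma> g c I W else 0)"
    unfolding normal_flux_def normal_def by (intro sum.cong) (auto simp: axis_def)
  then show ?thesis by simp
qed

text \<open>Both traces use the same geometry and weight, so the flux difference is half the sum of an interior
  and an exterior expression of the form treated by \<open>flux_split\<close>. The full multiple \<open>a W\<^sup>-\<close>, rather than
  one half of it, is what the interior state pays, so the time step condition charges each face node with
  the full speed.\<close>

lemma LLF_split:
  assumes \<Gamma>: "1 < \<Gamma>" "\<Gamma> \<le> 2"
    and lapse: "lapse g > 0" and sym: "transpose (gam g) = gam g"
    and pos: "\<And>u. u \<noteq> 0 \<Longrightarrow> u \<bullet> (gam g *v u) > 0"
    and c: "c > 0" and W: "Wm \<in> adm_cone" "Wp \<in> adm_cone"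
    and a: "a \<ge> causal_speed g (fst f)"
  shows "a *\<^sub>R Wm - LLF \<Gamma> (normal f) a g c Wm g c Wp \<in> adm_cone"
proof -
  have e: "\<bar>eps f\<bar> = 1" by (simp add: eps_def)
  have eq: "a *\<^sub>R Wm - LLF \<Gamma> (normal f) a g c Wm g c Wp =
      (1/2) *\<^sub>R ((a *\<^sub>R Wm - eps f *\<^sub>R flux \<Gamma> g c (fst f) Wm)
        + (a *\<^sub>R Wp - eps f *\<^sub>R flux \<Gamma> g c (fst f) Wp))"
  proof -
    have half: "a *\<^sub>R Wm = (a / 2) *\<^sub>R Wm + (a / 2) *\<^sub>R Wm"
      by (simp flip: scaleR_add_left)
    show ?thesis
      unfolding LLF_def normal_flux_eq
      by (subst half) (simp add: algebra_simps)
  qed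
  show ?thesis
    unfolding eq
    by (intro adm_cone_scale adm_cone_add flux_split[OF \<Gamma> lapse sym pos c _ a e] W) simp_all
qed

section \<open>Assembly over the element\<close>

lemma GLL_node_bounds:
  assumes "GLL N \<xi> \<omega>" "i \<le> N"
  shows "-1 \<le> \<xi> i" "\<xi> i \<le> 1"
proof -
  have sm: "strict_mono_on {0..N} \<xi>" and ends: "\<xi> 0 = -1" "\<xi> N = 1"
    using assms(1) by (auto simp: GLL_def)
  have "\<xi> 0 \<le> \<xi> i" "\<xi> i \<le> \<xi> N"
    using strict_mono_on_leD[OF sm, of 0 i] strict_mono_on_leD[OF sm, of i N] assms(2) by auto
  with ends show "-1 \<le> \<xi> i" "\<xi> i \<le> 1" by auto
qed

lemma node_pos_in_cbox:
  assumes gll: "GLL N \<xi> \<omega>" and el: "\<forall>I. xL $ I < xR $ I" and l: "l \<in> vol_nodes N"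
  shows "node_pos \<xi> xL xR l \<in> cbox xL xR"
  unfolding mem_box_cart
proof (intro allI)
  fix I
  have "idx l I \<le> N" using l by (auto simp: vol_nodes_def idx_def)
  note b = GLL_node_bounds[OF gll this]
  have d: "xR $ I - xL $ I > 0" using el by simp
  have "(xR $ I - xL $ I) * \<xi> (idx l I) \<le> (xR $ I - xL $ I) * 1"
    "(xR $ I - xL $ I) * (-1) \<le> (xR $ I - xL $ I) * \<xi> (idx l I)"
    using b d by (simp_all only: mult_le_cancel_left_pos)
  then show "xL $ I \<le> node_pos \<xi> xL xR l $ I \<and> node_pos \<xi> xL xR l $ I \<le> xR $ I"
    by (simp add: node_pos_def dx_def field_simps)
qed

lemma finite_vol_nodes: "finite (vol_nodes N)"
  by (simp add: vol_nodes_def)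

lemma vol_node_in_vol_nodes: "q \<le> N \<Longrightarrow> vol_node N f q \<in> vol_nodes N"
  by (simp add: vol_node_def vol_nodes_def Let_def)

text \<open>A corner node belongs to two faces, and a node in the interior of the element to none; collecting
  the face terms node by node gives each volume node the sum that appears in its time step condition.\<close>

lemma face_sum_regroup:
  fixes c :: "face \<Rightarrow> nat \<Rightarrow> real" and X :: "node \<Rightarrow> 'a::real_vector"
  shows "(\<Sum>f\<in>UNIV. \<Sum>q=0..N. c f q *\<^sub>R X (vol_node N f q)) =
    (\<Sum>l\<in>vol_nodes N. (\<Sum>(f, q)\<in>{(f, q). q \<le> N \<and> vol_node N f q = l}. c f q) *\<^sub>R X l)"
proof -
  let ?P = "UNIV \<times> {0..N} :: (face \<times> nat) set"
  have fin: "finite ?P" by simp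
  have grp: "{x \<in> ?P. (case x of (f, q) \<Rightarrow> vol_node N f q) = l} =
      {(f, q). q \<le> N \<and> vol_node N f q = l}" for l
    by auto
  have "(\<Sum>f\<in>UNIV. \<Sum>q=0..N. c f q *\<^sub>R X (vol_node N f q)) =
      (\<Sum>(f, q)\<in>?P. c f q *\<^sub>R X (vol_node N f q))"
    by (rule sum.cartesian_product)
  also have "\<dots> = (\<Sum>l\<in>vol_nodes N. \<Sum>(f, q)\<in>{(f, q). q \<le> N \<and> vol_node N f q = l}.
      c f q *\<^sub>R X (vol_node N f q))"
    unfolding grp[symmetric]
    by (rule sum.group[symmetric, OF fin]) (auto simp: finite_vol_nodes intro: vol_node_in_vol_nodes)
  also have "\<dots> = (\<Sum>l\<in>vol_nodes N.
      (\<Sum>(f, q)\<in>{(f, q). q \<le> N \<and> vol_node N f q = l}. c f q) *\<^sub>R X l)"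
    unfolding scaleR_sum_left by (intro sum.cong) auto
  finally show ?thesis .
qed

theorem theorem4p3:
  fixes \<Gamma> \<Delta>t :: real and N :: nat and \<xi> \<omega> :: "nat \<Rightarrow> real"
    and \<Omega> :: "(real^2) set" and geo :: "real^2 \<Rightarrow> geometry" and w :: "real^2 \<Rightarrow> real"
    and xL xR :: "real^2"
    and W :: "node \<Rightarrow> state"
    and geo_ext :: "face \<Rightarrow> nat \<Rightarrow> geometry" and w_ext :: "face \<Rightarrow> nat \<Rightarrow> real"
    and W_ext :: "face \<Rightarrow> nat \<Rightarrow> state"
    and a :: "face \<Rightarrow> nat \<Rightarrow> real"
  defines "geoN \<equiv> \<lambda>l. geo (node_pos \<xi> xL xR l)"
    and "wN \<equiv> \<lambda>l. w (node_pos \<xi> xL xR l)"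
  defines "S \<equiv> discrete_source \<Gamma> N \<xi> xL xR geoN wN W"
  assumes Gamma: "1 < \<Gamma>" "\<Gamma> \<le> 2"
    and gll: "GLL N \<xi> \<omega>"
    and element: "\<forall>I. xL $ I < xR $ I"
    and geometry: "open \<Omega>" "cbox xL xR \<subseteq> \<Omega>" "smooth_geometry \<Omega> geo" "smooth_fun \<Omega> w"
    and time_step: "\<Delta>t > 0"
    and weight_vol: "\<forall>l\<in>vol_nodes N. wN l > 0"
    and weight_face: "\<forall>f. \<forall>q\<le>N. w_ext f q > 0"
    and single_valued: "\<forall>f. \<forall>q\<le>N. geo_ext f q = geoN (vol_node N f q) \<and>
                                   w_ext f q = wN (vol_node N f q)"
    and states_vol: "\<forall>l\<in>vol_nodes N. W l \<in> adm_cone"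
    and states_ext: "\<forall>f. \<forall>q\<le>N. W_ext f q \<in> adm_cone"
    and speeds: "\<forall>f. \<forall>q\<le>N. a f q \<ge> causal_speed (geoN (vol_node N f q)) (fst f)"
    and cfl: "\<forall>l\<in>vol_nodes N.
      \<Delta>t * (escape_rate (W l) (S l)
             + 4 / (\<omega> (fst l) * \<omega> (snd l) * area xL xR)
               * (\<Sum>(f, q)\<in>{(f, q). q \<le> N \<and> vol_node N f q = l}. \<omega> q * J_face xL xR f * a f q)) < 1"
  shows "cell_average N \<omega> (\<lambda>l. W l + \<Delta>t *\<^sub>R S l)
      - (\<Delta>t / area xL xR) *\<^sub>R (\<Sum>f\<in>UNIV. \<Sum>q=0..N. (J_face xL xR f * \<omega> q) *\<^sub>R
          LLF \<Gamma> (normal f) (a f q)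
            (geoN (vol_node N f q)) (wN (vol_node N f q)) (W (vol_node N f q))
            (geo_ext f q) (w_ext f q) (W_ext f q))
      \<in> adm_cone"
proof -
  have weights: "\<omega> i > 0" if "i \<le> N" for i
    using gll that unfolding GLL_def by blast
  define A where "A = area xL xR"
  have dx: "dx xL xR I > 0" for I
    using element by (simp add: dx_def)
  have A: "A > 0"
    using dx by (simp add: A_def area_def J_elem_def)
  have Jf: "J_face xL xR f > 0" for f
    using dx by (simp add: J_face_def J_elem_def kap_def)
  define J where "J = J_face xL xR"
  define vn where "vn = vol_node N"
  define k where "k = (\<lambda>l. \<Sum>(f, q)\<in>{(f, q). q \<le> N \<and> vol_node N f q = l}. \<omega> q * J f * a f q)"
  define F where "F = (\<lambda>f q. LLF \<Gamma> (normal f) (a f q) (geoN (vn f q)) (wN (vn f q)) (W (vn f q))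
            (geo_ext f q) (w_ext f q) (W_ext f q))"
  define \<Omega>l where "\<Omega>l = (\<lambda>l. \<omega> (fst l) * \<omega> (snd l))"
  have \<Omega>l: "\<Omega>l l > 0" if "l \<in> vol_nodes N" for l
    using that weights by (auto simp: \<Omega>l_def vol_nodes_def)
  \<comment> \<open>The flux leaving through a face node is \<open>a W\<^sup>-\<close> minus an admissible vector.\<close>
  have face: "a f q *\<^sub>R W (vn f q) - F f q \<in> adm_cone" if q: "q \<le> N" for f q
  proof -
    have l: "vn f q \<in> vol_nodes N"
      unfolding vn_def by (rule vol_node_in_vol_nodes[OF q])
    then have "node_pos \<xi> xL xR (vn f q) \<in> \<Omega>"
      using node_pos_in_cbox[OF gll element] geometry(2) by blast
    then have g: "lapse (geoN (vn f q)) > 0" "transpose (gam (geoN (vn f q))) = gam (geoN (vn f q))"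
      "\<And>u. u \<noteq> 0 \<Longrightarrow> u \<bullet> (gam (geoN (vn f q)) *v u) > 0"
      using geometry(3) by (simp_all add: smooth_geometry_def geoN_def)
    have ext: "geo_ext f q = geoN (vn f q)" "w_ext f q = wN (vn f q)"
      using single_valued q unfolding vn_def by blast+
    show ?thesis
      unfolding F_def ext
    proof (rule LLF_split[OF Gamma g])
      show "wN (vn f q) > 0" "W (vn f q) \<in> adm_cone"
        using weight_vol states_vol l by blast+
      show "W_ext f q \<in> adm_cone" "causal_speed (geoN (vn f q)) (fst f) \<le> a f q"
        using states_ext speeds q unfolding vn_def by blast+
    qed
  qed
  \<comment> \<open>Charging the multiples \<open>a W\<^sup>-\<close> to the volume nodes leaves a remainder that still absorbs the source.\<close>
  have node: "(1 - \<Delta>t * (4 / (\<Omega>l l * A) * k l)) *\<^sub>R W l + \<Delta>t *\<^sub>R S l \<in> adm_cone"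
    if l: "l \<in> vol_nodes N" for l
  proof (rule source_step_in_adm_cone)
    show "W l \<in> adm_cone" using states_vol l by blast
    show "\<Delta>t > 0" by (rule time_step)
    have "\<Delta>t * (escape_rate (W l) (S l) + 4 / (\<Omega>l l * A) * k l) < 1"
      unfolding \<Omega>l_def A_def k_def J_def using cfl l by blast
    then show "\<Delta>t * escape_rate (W l) (S l) < 1 - \<Delta>t * (4 / (\<Omega>l l * A) * k l)"
      by (simp add: distrib_left)
  qed
  have vol: "(1/4) *\<^sub>R (\<Sum>l\<in>vol_nodes N. \<Omega>l l *\<^sub>R
      ((1 - \<Delta>t * (4 / (\<Omega>l l * A) * k l)) *\<^sub>R W l + \<Delta>t *\<^sub>R S l)) \<in> adm_cone"
    by (intro adm_cone_scale adm_cone_sum node \<Omega>l) (auto simp: vol_nodes_def)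
  have faces: "(\<Delta>t / A) *\<^sub>R (\<Sum>f\<in>UNIV. \<Sum>q=0..N. (J f * \<omega> q) *\<^sub>R (a f q *\<^sub>R W (vn f q) - F f q)) \<in> adm_cone"
    using time_step A Jf weights unfolding J_def
    by (intro adm_cone_scale adm_cone_sum face) auto
  have split: "\<Omega>l l *\<^sub>R ((1 - \<Delta>t * (4 / (\<Omega>l l * A) * k l)) *\<^sub>R W l + \<Delta>t *\<^sub>R S l) =
      \<Omega>l l *\<^sub>R (W l + \<Delta>t *\<^sub>R S l) - (4 * \<Delta>t / A) *\<^sub>R k l *\<^sub>R W l"
    if l: "l \<in> vol_nodes N" for l
  proof -
    have "\<Omega>l l * (\<Delta>t * (4 / (\<Omega>l l * A) * k l)) = 4 * \<Delta>t / A * k l"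
      using \<Omega>l[OF l] A by (simp add: field_simps)
    then show ?thesis
      by (simp add: scaleR_add_right scaleR_diff_left algebra_simps)
  qed
  have regroup: "(\<Sum>f\<in>UNIV. \<Sum>q=0..N. (J f * \<omega> q) *\<^sub>R a f q *\<^sub>R W (vn f q)) =
      (\<Sum>l\<in>vol_nodes N. k l *\<^sub>R W l)"
    using face_sum_regroup[of "\<lambda>f q. \<omega> q * J f * a f q" W N]
    by (simp add: k_def vn_def mult_ac)
  \<comment> \<open>The charged multiples are subtracted from the volume part here and are returned by the face part below.\<close>
  have vol_eq: "(1/4) *\<^sub>R (\<Sum>l\<in>vol_nodes N. \<Omega>l l *\<^sub>R
      ((1 - \<Delta>t * (4 / (\<Omega>l l * A) * k l)) *\<^sub>R W l + \<Delta>t *\<^sub>R S l)) =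
      cell_average N \<omega> (\<lambda>l. W l + \<Delta>t *\<^sub>R S l) - (\<Delta>t / A) *\<^sub>R (\<Sum>l\<in>vol_nodes N. k l *\<^sub>R W l)"
  proof -
    have "(\<Sum>l\<in>vol_nodes N. \<Omega>l l *\<^sub>R
      ((1 - \<Delta>t * (4 / (\<Omega>l l * A) * k l)) *\<^sub>R W l + \<Delta>t *\<^sub>R S l)) =
      (\<Sum>l\<in>vol_nodes N. \<Omega>l l *\<^sub>R (W l + \<Delta>t *\<^sub>R S l)) - (4 * \<Delta>t / A) *\<^sub>R (\<Sum>l\<in>vol_nodes N. k l *\<^sub>R W l)"
      unfolding scaleR_sum_right sum_subtractf[symmetric] by (rule sum.cong[OF refl split])
    then show ?thesis
      by (simp add: cell_average_def \<Omega>l_def scaleR_diff_right)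
  qed
  have face_eq: "(\<Delta>t / A) *\<^sub>R (\<Sum>f\<in>UNIV. \<Sum>q=0..N. (J f * \<omega> q) *\<^sub>R (a f q *\<^sub>R W (vn f q) - F f q)) =
      (\<Delta>t / A) *\<^sub>R (\<Sum>l\<in>vol_nodes N. k l *\<^sub>R W l)
        - (\<Delta>t / A) *\<^sub>R (\<Sum>f\<in>UNIV. \<Sum>q=0..N. (J f * \<omega> q) *\<^sub>R F f q)"
    unfolding scaleR_diff_right sum_subtractf regroup ..
  have "cell_average N \<omega> (\<lambda>l. W l + \<Delta>t *\<^sub>R S l)
      - (\<Delta>t / A) *\<^sub>R (\<Sum>f\<in>UNIV. \<Sum>q=0..N. (J f * \<omega> q) *\<^sub>R F f q) \<in> adm_cone"
    using adm_cone_add[OF vol faces] unfolding vol_eq face_eq by simp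
  then show ?thesis
    unfolding A_def J_def F_def vn_def .
qed

end
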